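(* There is a nonrecursive bounded finite-one degree such that the collection of all one-one degrees contained in it, ordered by one-one reducibility, forms an ascending chain of the same order type as the natural numbers.
   Context: All sets are subsets of $\mathbb{N}=\{0,1,2,\ldots\}$, identified with their characteristic functions. A many-one reduction from $A$ to $B$ is a total recursive function $f:\mathbb{N}\to\mathbb{N}$ with $A(x)=B(f(x))$ for all $x$. It is a bounded finite-one reduction if there is a constant $c$ such that for every $y$ there are at most $c$ numbers $x$ with $f(x)=y$, and a one-one reduction if for each $y$ there is at most one $x$ with $f(x)=y$. $A$ is bounded finite-one (one-one) reducible to $B$ if such a reduction exists; the bounded finite-one (one-one) degree of $A$ is the set of all $B\subseteq\mathbb{N}$ such that $A$ and $B$ are reducible to each other in that sense. A degree is nonrecursive if its members are nonrecursive sets. One-one degrees are ordered by one-one reducibility of representatives. *)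

theory Defs
  imports Main
begin

section \<open>Recursive functions and sets\<close>

text \<open>
  Partial recursive functions are given by Kleene's mu-recursive schemes. Terms carry no arity;
  on argument lists of a fixed length, every term computes a partial recursive function of that
  arity.
\<close>

datatype recf =
    Zero
  | Succ
  | Proj nat
  | Comp recf "recf list"
  | Prim_Rec recf recf
  | Mu recf

inductive computes :: "recf \<Rightarrow> nat list \<Rightarrow> nat \<Rightarrow> bool" where
  Zero: "computes Zero xs 0"
| Succ: "computes Succ [x] (Suc x)"
| Proj: "i < length xs \<Longrightarrow> computes (Proj i) xs (xs ! i)"
| Comp: "list_all2 (\<lambda>g y. computes g xs y) gs ys \<Longrightarrow> computes f ys z
          \<Longrightarrow> computes (Comp f gs) xs z"
| Prim_Rec_0: "computes f xs z \<Longrightarrow> computes (Prim_Rec f g) (0 # xs) z"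
| Prim_Rec_Suc: "computes (Prim_Rec f g) (n # xs) y \<Longrightarrow> computes g (n # y # xs) z
          \<Longrightarrow> computes (Prim_Rec f g) (Suc n # xs) z"
| Mu: "computes f (y # xs) 0 \<Longrightarrow> (\<forall>i<y. \<exists>v. computes f (i # xs) (Suc v))
          \<Longrightarrow> computes (Mu f) xs y"
monos list_all2_mono

lemma computes_deterministic:
  assumes "computes r xs y" and "computes r xs z"
  shows "y = z"
  using assms
proof (induction arbitrary: z rule: computes.induct)
  case (Comp xs gs ys f w)
  from Comp.prems obtain ys' where ys': "list_all2 (\<lambda>g y. computes g xs y) gs ys'" "computes f ys' z"
    by (cases rule: computes.cases) auto
  have "ys = ys'"
  proof (rule nth_equalityI)
    show "length ys = length ys'"
      using Comp.IH(1) ys'(1) by (simp add: list_all2_conv_all_nth)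
    show "ys ! i = ys' ! i" if "i < length ys" for i
      using that Comp.IH(1) ys'(1) unfolding list_all2_conv_all_nth by metis
  qed
  then show ?case
    using Comp.IH(2) ys'(2) by simp
next
  case (Prim_Rec_0 f xs w g)
  from Prim_Rec_0.prems have "computes f xs z"
    by (cases rule: computes.cases) auto
  then show ?case
    by (rule Prim_Rec_0.IH)
next
  case (Prim_Rec_Suc f g n xs y w)
  from Prim_Rec_Suc.prems obtain y' where "computes (Prim_Rec f g) (n # xs) y'" "computes g (n # y' # xs) z"
    by (cases rule: computes.cases) auto
  then show ?case
    using Prim_Rec_Suc.IH by blast
next
  case (Mu f y xs)
  from Mu.prems have z: "computes f (z # xs) 0" "\<forall>i<z. \<exists>v. computes f (i # xs) (Suc v)"
    by (auto elim: computes.cases)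
  have "\<not> y < z"
    using Mu.IH(1) z(2) by (metis nat.distinct(1))
  moreover have "\<not> z < y"
    using Mu.IH(2) z(1) by (metis nat.distinct(1))
  ultimately show ?case by simp
qed (erule computes.cases, simp_all)+

definition total_recursive :: "(nat \<Rightarrow> nat) \<Rightarrow> bool" where
  "total_recursive f \<longleftrightarrow> (\<exists>r. \<forall>x. computes r [x] (f x))"

definition recursive_set :: "nat set \<Rightarrow> bool" where
  "recursive_set A \<longleftrightarrow> total_recursive (\<lambda>x. if x \<in> A then 1 else 0)"

lemma total_recursive_id: "total_recursive (\<lambda>x. x)"
proof -
  have "computes (Proj 0) [x] x" for x
    using computes.Proj[of 0 "[x]"] by simp
  then show ?thesis
    unfolding total_recursive_def by blast
qed

lemma total_recursive_comp:
  assumes "total_recursive f" and "total_recursive g"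
  shows "total_recursive (\<lambda>x. g (f x))"
proof -
  obtain r s where "\<And>x. computes r [x] (f x)" "\<And>x. computes s [x] (g x)"
    using assms unfolding total_recursive_def by blast
  then have "computes (Comp s [r]) [x] (g (f x))" for x
    by (intro computes.Comp[where ys = "[f x]"]) auto
  then show ?thesis
    unfolding total_recursive_def by blast
qed


section \<open>Reducibilities and degrees\<close>

definition many_one_reduction :: "(nat \<Rightarrow> nat) \<Rightarrow> nat set \<Rightarrow> nat set \<Rightarrow> bool" where
  "many_one_reduction f A B \<longleftrightarrow> total_recursive f \<and> (\<forall>x. x \<in> A \<longleftrightarrow> f x \<in> B)"

definition bfo_reducible :: "nat set \<Rightarrow> nat set \<Rightarrow> bool" where
  "bfo_reducible A B \<longleftrightarrow>
     (\<exists>f. many_one_reduction f A B \<and>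
          (\<exists>c. \<forall>y. finite {x. f x = y} \<and> card {x. f x = y} \<le> c))"

definition one_one_reducible :: "nat set \<Rightarrow> nat set \<Rightarrow> bool" where
  "one_one_reducible A B \<longleftrightarrow> (\<exists>f. many_one_reduction f A B \<and> inj f)"

definition bfo_degree :: "nat set \<Rightarrow> nat set set" where
  "bfo_degree A = {B. bfo_reducible A B \<and> bfo_reducible B A}"

definition one_one_degree :: "nat set \<Rightarrow> nat set set" where
  "one_one_degree A = {B. one_one_reducible A B \<and> one_one_reducible B A}"

definition nonrecursive_degree :: "nat set set \<Rightarrow> bool" where
  "nonrecursive_degree D \<longleftrightarrow> (\<forall>A\<in>D. \<not> recursive_set A)"

definition one_one_degrees_in :: "nat set set \<Rightarrow> nat set set set" where
  "one_one_degrees_in D = {d \<in> range one_one_degree. d \<subseteq> D}"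

definition degree_le :: "nat set set \<Rightarrow> nat set set \<Rightarrow> bool" where
  "degree_le d e \<longleftrightarrow> (\<exists>A\<in>d. \<exists>B\<in>e. one_one_reducible A B)"

definition one_one_order :: "nat set set \<Rightarrow> nat set set rel" where
  "one_one_order D =
     {(d, e). d \<in> one_one_degrees_in D \<and> e \<in> one_one_degrees_in D \<and> degree_le d e}"

lemma one_one_reducible_refl: "one_one_reducible A A"
  unfolding one_one_reducible_def many_one_reduction_def
  using total_recursive_id by (intro exI[of _ "\<lambda>x. x"]) auto

lemma one_one_reducible_trans:
  assumes "one_one_reducible A B" and "one_one_reducible B C"
  shows "one_one_reducible A C"
proof -
  obtain f where f: "many_one_reduction f A B" "inj f"
    using assms(1) by (auto simp only: one_one_reducible_def)
  obtain g where g: "many_one_reduction g B C" "inj g"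
    using assms(2) by (auto simp only: one_one_reducible_def)
  have "many_one_reduction (\<lambda>x. g (f x)) A C"
    using f(1) g(1) total_recursive_comp[of f g] by (simp add: many_one_reduction_def)
  moreover have "inj (\<lambda>x. g (f x))"
    using inj_compose[OF g(2) f(2)] by (simp add: comp_def)
  ultimately show ?thesis
    unfolding one_one_reducible_def by (intro exI conjI)
qed

lemma degree_le_iff:
  "degree_le (one_one_degree A) (one_one_degree B) \<longleftrightarrow> one_one_reducible A B"
  unfolding degree_le_def one_one_degree_def
  using one_one_reducible_refl one_one_reducible_trans by blast

lemma Field_one_one_order: "Field (one_one_order D) = one_one_degrees_in D"
proof -
  have "degree_le d d" if "d \<in> one_one_degrees_in D" for d
    using that degree_le_iff one_one_reducible_refl by (auto simp: one_one_degrees_in_def)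
  then show ?thesis
    unfolding Field_def one_one_order_def by blast
qed

end

theory Submission
  imports Defs "HOL-Library.Countable_Set"
begin

text \<open>
  The degree is that of a set with almost no recursive symmetries, padded so that finite changes do not
  matter. Write \<open>C \<subseteq>\<^sup>* R\<close> when \<open>C - R\<close> is finite. The core is an
  infinite set \<open>C\<close> such that

  \<^item> every recursively enumerable \<open>W\<close> is decided by a recursive \<open>R\<close> with
    \<open>C \<subseteq>\<^sup>* R\<close>, in the sense that \<open>R \<subseteq> W\<close> or \<open>R
    \<inter> W = {}\<close>;
  \<^item> every recursive finite-one \<open>p\<close> has a recursive \<open>R\<close> with \<open>C
    \<subseteq>\<^sup>* R\<close> on which \<open>p\<close> is the identity, or whose image under
    \<open>p\<close> misses \<open>R\<close>.

  Such a set is found by a forcing argument with infinite recursive sets as conditions. There are only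
  countably many requirements, each can be met by shrinking a given infinite recursive set, and
  \<open>C\<close> picks one element from each member of the resulting descending sequence
  (\<open>generic_set_exists\<close>, \<open>rigid_exists\<close>).

  Let \<open>copies k C\<close> consist of \<open>k\<close> interleaved copies of \<open>C\<close>, one copy
  of \<open>\<nat>\<close> and one copy of \<open>{}\<close>. A recursive finite-one reduction of
  \<open>C\<close> to \<open>copies k C\<close> sends almost every element of \<open>C\<close> to one of its
  own \<open>k\<close> copies (\<open>self_reduction_almost_identity\<close>): on a set \<open>R\<close>
  moved off itself, infinitely many elements of \<open>C\<close> would land outside \<open>R\<close>, where
  \<open>C\<close> has only finitely many. Counting the copies of a single element then shows that
  \<open>copies k C\<close> is one-one reducible to \<open>copies j C\<close> exactly if \<open>k \<le>
  j\<close>, so the sets \<open>copies k C\<close> with \<open>k \<ge> 1\<close> give an ascending chain of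
  one-one degrees inside the bounded finite-one degree of \<open>copies 1 C\<close>.

  The chain exhausts that degree. Let \<open>f\<close> reduce \<open>B\<close> to \<open>copies 1 C\<close>
  with boundedly many preimages. The elements whose copy has more than \<open>j\<close> preimages under
  \<open>f\<close> form a recursively enumerable set, so almost all elements of \<open>C\<close> lie in it
  or almost all lie outside; hence almost all elements of \<open>C\<close> have the same number
  \<open>k\<close> of preimages (\<open>almost_constant_multiplicity\<close>). It is positive because a
  reduction back followed by \<open>f\<close> is almost the identity on \<open>C\<close>. Listing each fibre
  in increasing order matches the elements of \<open>B\<close> with \<open>k\<close> copies of
  \<open>C\<close>. The finitely many exceptions, and all arguments whose membership is already known, are
  sent into the recursive copies of \<open>\<nat>\<close> and \<open>{}\<close>, or into infinite recursive
  subsets of \<open>B\<close> and of its complement. So \<open>B\<close> and \<open>copies k C\<close> have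
  the same one-one degree (\<open>bfo_degree_classification\<close>).
\<close>


section \<open>Recursive functions of several variables\<close>

text \<open>
  The function takes the list of its arguments as an environment, so that composite expressions can be shown
  recursive by following their syntax: variables are entries of the environment, and a binder puts its bound
  variable in front.
\<close>

definition recfun :: "nat \<Rightarrow> (nat list \<Rightarrow> nat) \<Rightarrow> bool" where
  "recfun n F \<longleftrightarrow> (\<exists>r. \<forall>e. length e = n \<longrightarrow> computes r e (F e))"

definition recrel :: "nat \<Rightarrow> (nat list \<Rightarrow> bool) \<Rightarrow> bool" where
  "recrel n P \<longleftrightarrow> recfun n (\<lambda>e. of_bool (P e))"

lemma total_recursive_iff: "total_recursive f \<longleftrightarrow> recfun (Suc 0) (\<lambda>e. f (e ! 0))"
proof -
  have "(\<forall>x. computes r [x] (f x)) \<longleftrightarrow>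
      (\<forall>e. length e = Suc 0 \<longrightarrow> computes r e (f (e ! 0)))" for r
    by (auto simp: length_Suc_conv)
  then show ?thesis
    unfolding total_recursive_def recfun_def by simp
qed

lemma recursive_set_iff: "recursive_set S \<longleftrightarrow> recrel (Suc 0) (\<lambda>e. e ! 0 \<in> S)"
  unfolding recursive_set_def recrel_def total_recursive_iff of_bool_def ..

lemma recfun_cong:
  assumes "recfun n F" and "\<And>e. length e = n \<Longrightarrow> F e = G e"
  shows "recfun n G"
  using assms unfolding recfun_def by fastforce

lemma recfun_nth: "i < n \<Longrightarrow> recfun n (\<lambda>e. e ! i)"
  unfolding recfun_def using computes.Proj by blast

lemma recfun_comp1:
  assumes "\<And>x. computes s [x] (f x)" and "recfun n a"
  shows "recfun n (\<lambda>e. f (a e))"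
proof -
  obtain r where r: "\<And>e. length e = n \<Longrightarrow> computes r e (a e)"
    using assms(2) unfolding recfun_def by blast
  have "computes (Comp s [r]) e (f (a e))" if "length e = n" for e
    using r[OF that] assms(1)[of "a e"] by (intro computes.Comp[where ys = "[a e]"]) auto
  then show ?thesis
    unfolding recfun_def by blast
qed

lemma recfun_app: "total_recursive f \<Longrightarrow> recfun n a \<Longrightarrow> recfun n (\<lambda>e. f (a e))"
  unfolding total_recursive_def using recfun_comp1 by blast

lemma recfun_Suc: "recfun n a \<Longrightarrow> recfun n (\<lambda>e. Suc (a e))"
  by (rule recfun_comp1[OF computes.Succ])

lemma recfun_const: "recfun n (\<lambda>e. c)"
proof (induction c)
  case 0
  show ?case
    unfolding recfun_def using computes.Zero by blast
qed (rule recfun_Suc)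

lemma computes_Proj_upt:
  assumes "length e = m + n"
  shows "list_all2 (\<lambda>g y. computes g e y) (map Proj [m..<m + n]) (drop m e)"
  unfolding list_all2_conv_all_nth
  using assms by (simp add: computes.Proj)

lemma recfun_tl:
  assumes "recfun n F"
  shows "recfun (Suc n) (\<lambda>e. F (tl e))"
proof -
  obtain r where r: "\<And>e. length e = n \<Longrightarrow> computes r e (F e)"
    using assms unfolding recfun_def by blast
  have "computes (Comp r (map Proj [1..<1 + n])) e (F (tl e))" if "length e = Suc n" for e
  proof (rule computes.Comp)
    show "list_all2 (\<lambda>g y. computes g e y) (map Proj [1..<1 + n]) (tl e)"
      using computes_Proj_upt[of e 1 n] that by (simp add: drop_Suc)
    show "computes r (tl e) (F (tl e))"
      using r that by simp
  qed
  then show ?thesis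
    unfolding recfun_def by blast
qed

lemma recfun_nth_tl: "i < n \<Longrightarrow> recfun (Suc n) (\<lambda>e. tl e ! i)"
  by (rule recfun_tl[OF recfun_nth])

text \<open>
  The step function receives the counter, the previous value and the environment; in list form the first two
  are the two front entries, which leaves the environment two tails deep.
\<close>

lemma recfun_rec:
  assumes "recfun n a" and "recfun n z"
    and "recfun (Suc (Suc n)) (\<lambda>e. s (e ! 0) (e ! 1) (tl (tl e)))"
  shows "recfun n (\<lambda>e. rec_nat (z e) (\<lambda>i y. s i y e) (a e))"
proof -
  obtain ra where ra: "\<And>e. length e = n \<Longrightarrow> computes ra e (a e)"
    using assms(1) unfolding recfun_def by blast
  obtain rz where rz: "\<And>e. length e = n \<Longrightarrow> computes rz e (z e)"
    using assms(2) unfolding recfun_def by blast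
  obtain rs where rs: "\<And>e. length e = Suc (Suc n) \<Longrightarrow>
      computes rs e (s (e ! 0) (e ! 1) (tl (tl e)))"
    using assms(3) unfolding recfun_def by blast
  have "computes (Comp (Prim_Rec rz rs) (ra # map Proj [0..<0 + n])) e
          (rec_nat (z e) (\<lambda>i y. s i y e) (a e))" if e: "length e = n" for e
  proof (rule computes.Comp)
    show "list_all2 (\<lambda>g y. computes g e y) (ra # map Proj [0..<0 + n]) (a e # e)"
      using ra[OF e] computes_Proj_upt[of e 0 n] e by simp
    have "computes (Prim_Rec rz rs) (m # e) (rec_nat (z e) (\<lambda>i y. s i y e) m)" for m
    proof (induction m)
      case 0
      show ?case
        using rz[OF e] by (simp add: computes.Prim_Rec_0)
    next
      case (Suc m)
      show ?case
        using computes.Prim_Rec_Suc[OF Suc rs[of "m # _ # e"]] e by simp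
    qed
    then show "computes (Prim_Rec rz rs) (a e # e) (rec_nat (z e) (\<lambda>i y. s i y e) (a e))" .
  qed
  then show ?thesis
    unfolding recfun_def by blast
qed

lemma recfun_add:
  assumes "recfun n a" and "recfun n b"
  shows "recfun n (\<lambda>e. a e + b e)"
proof (rule recfun_cong)
  show "recfun n (\<lambda>e. rec_nat (a e) (\<lambda>i y. Suc y) (b e))"
    by (intro recfun_rec recfun_Suc recfun_nth assms) simp
  have "rec_nat x (\<lambda>i y. Suc y) m = x + m" for x m :: nat
    by (induction m) auto
  then show "rec_nat (a e) (\<lambda>i y. Suc y) (b e) = a e + b e" for e .
qed

lemma recfun_pred: "recfun n a \<Longrightarrow> recfun n (\<lambda>e. a e - 1)"
proof (rule recfun_cong)
  show "recfun n (\<lambda>e. rec_nat 0 (\<lambda>i y. i) (a e))" if "recfun n a"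
    using that by (intro recfun_rec recfun_const recfun_nth) simp_all
  show "rec_nat 0 (\<lambda>i y. i) (a e) = a e - 1" for e
    by (cases "a e") auto
qed

lemma recfun_minus:
  assumes "recfun n a" and "recfun n b"
  shows "recfun n (\<lambda>e. a e - b e)"
proof (rule recfun_cong)
  show "recfun n (\<lambda>e. rec_nat (a e) (\<lambda>i y. y - 1) (b e))"
    by (intro recfun_rec recfun_pred recfun_nth assms) simp
  have "rec_nat x (\<lambda>i y. y - 1) m = x - m" for x m :: nat
    by (induction m) auto
  then show "rec_nat (a e) (\<lambda>i y. y - 1) (b e) = a e - b e" for e .
qed

lemma recfun_mult:
  assumes "recfun n a" and "recfun n b"
  shows "recfun n (\<lambda>e. a e * b e)"
proof (rule recfun_cong)
  show "recfun n (\<lambda>e. rec_nat 0 (\<lambda>i y. y + a e) (b e))"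
    by (intro recfun_rec recfun_add recfun_const recfun_nth recfun_tl assms) simp
  have "rec_nat 0 (\<lambda>i y. y + x) m = x * m" for x m :: nat
    by (induction m) auto
  then show "rec_nat 0 (\<lambda>i y. y + a e) (b e) = a e * b e" for e .
qed

lemma recrel_not: "recrel n P \<Longrightarrow> recrel n (\<lambda>e. \<not> P e)"
  unfolding recrel_def
  by (rule recfun_cong[OF recfun_minus[OF recfun_const[of n 1]]]) auto

lemma recrel_conj: "recrel n P \<Longrightarrow> recrel n Q \<Longrightarrow> recrel n (\<lambda>e. P e \<and> Q e)"
  unfolding recrel_def of_bool_conj by (rule recfun_mult)

lemma recrel_disj:
  assumes "recrel n P" and "recrel n Q"
  shows "recrel n (\<lambda>e. P e \<or> Q e)"
  using recrel_not[OF recrel_conj[OF assms[THEN recrel_not]]] by simp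

lemma recrel_less:
  assumes "recfun n a" and "recfun n b"
  shows "recrel n (\<lambda>e. a e < b e)"
  unfolding recrel_def
proof (rule recfun_cong)
  show "recfun n (\<lambda>e. 1 - (1 - (b e - a e)))"
    by (intro recfun_minus recfun_const assms)
qed auto

lemma recrel_le:
  assumes "recfun n a" and "recfun n b"
  shows "recrel n (\<lambda>e. a e \<le> b e)"
  using recrel_not[OF recrel_less[OF assms(2,1)]] by (simp add: not_less)

lemma recrel_eq:
  assumes "recfun n a" and "recfun n b"
  shows "recrel n (\<lambda>e. a e = b e)"
  using recrel_conj[OF recrel_le[OF assms] recrel_le[OF assms(2,1)]] by (simp add: eq_iff)

lemma recrel_mem: "recursive_set S \<Longrightarrow> recfun n a \<Longrightarrow> recrel n (\<lambda>e. a e \<in> S)"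
  unfolding recursive_set_def recrel_def of_bool_def by (rule recfun_app)

lemma recfun_if:
  assumes "recrel n P" and "recfun n a" and "recfun n b"
  shows "recfun n (\<lambda>e. if P e then a e else b e)"
proof (rule recfun_cong)
  show "recfun n (\<lambda>e. of_bool (P e) * a e + (1 - of_bool (P e)) * b e)"
    using assms unfolding recrel_def by (intro recfun_add recfun_mult recfun_minus recfun_const)
qed simp

text \<open>
  Unbounded search; a front entry of the environment stands for the bound variable, which makes the
  remaining environment a tail.
\<close>

lemma recfun_Least:
  assumes P: "recrel (Suc n) (\<lambda>e. P (e ! 0) (tl e))"
    and ex: "\<And>e. length e = n \<Longrightarrow> \<exists>y. P y e"
  shows "recfun n (\<lambda>e. LEAST y. P y e)"
proof -
  obtain r where r: "\<And>e. length e = Suc n \<Longrightarrow> computes r e (of_bool (\<not> P (e ! 0) (tl e)))"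
    using recrel_not[OF P] unfolding recrel_def recfun_def by blast
  have "computes (Mu r) e (LEAST y. P y e)" if e: "length e = n" for e
  proof (rule computes.Mu)
    show "computes r ((LEAST y. P y e) # e) 0"
      using r[of "(LEAST y. P y e) # e"] LeastI_ex[OF ex[OF e]] e by simp
    show "\<forall>i<(LEAST y. P y e). \<exists>v. computes r (i # e) (Suc v)"
    proof (intro allI impI)
      fix i assume "i < (LEAST y. P y e)"
      then have "\<not> P i e"
        by (rule not_less_Least)
      then show "\<exists>v. computes r (i # e) (Suc v)"
        using r[of "i # e"] e by (intro exI[of _ 0]) simp
    qed
  qed
  then show ?thesis
    unfolding recfun_def by blast
qed

lemma recfun_div:
  assumes "0 < d" and "recfun n a"
  shows "recfun n (\<lambda>e. a e div d)"
proof (rule recfun_cong)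
  \<comment> \<open>the quotient is the first q whose next multiple of d exceeds the dividend\<close>
  show "recfun n (\<lambda>e. LEAST q. a e < d * Suc q)"
  proof (rule recfun_Least)
    show "recrel (Suc n) (\<lambda>e. a (tl e) < d * Suc (e ! 0))"
      by (intro recrel_less recfun_mult recfun_Suc recfun_const recfun_nth recfun_tl assms) simp
    show "\<exists>q. a e < d * Suc q" for e
      unfolding mult_Suc_right using dividend_less_times_div[OF assms(1)] by blast
  qed
  show "(LEAST q. a e < d * Suc q) = a e div d" for e
  proof (rule Least_equality)
    show "a e < d * Suc (a e div d)"
      unfolding mult_Suc_right by (rule dividend_less_times_div[OF assms(1)])
    show "a e div d \<le> q" if "a e < d * Suc q" for q
      using that unfolding mult.commute[of d] div_less_iff_less_mult[OF assms(1), symmetric]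
      by (rule less_Suc_eq_le[THEN iffD1])
  qed
qed

lemma recfun_mod: "0 < d \<Longrightarrow> recfun n a \<Longrightarrow> recfun n (\<lambda>e. a e mod d)"
  unfolding minus_div_mult_eq_mod[symmetric] by (intro recfun_minus recfun_mult recfun_div recfun_const)

lemmas recfun_intros = recfun_nth recfun_nth_tl recfun_const recfun_Suc
  recfun_add recfun_minus recfun_mult recfun_div recfun_mod recfun_if
  recrel_not recrel_conj recrel_disj recrel_less recrel_le recrel_eq

lemma recursive_set_Int: "recursive_set S \<Longrightarrow> recursive_set T \<Longrightarrow> recursive_set (S \<inter> T)"
  unfolding recursive_set_iff Int_iff by (rule recrel_conj)

lemma recursive_set_Compl: "recursive_set S \<Longrightarrow> recursive_set (- S)"
  unfolding recursive_set_iff Compl_iff by (rule recrel_not)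

lemma recursive_set_finite: "finite S \<Longrightarrow> recursive_set S"
proof (induction rule: finite_induct)
  case empty
  show ?case
    unfolding recursive_set_iff recrel_def by (simp add: recfun_const)
next
  case (insert x S)
  then show ?case
    unfolding recursive_set_iff insert_iff by (intro recfun_intros) simp_all
qed

lemma recursive_set_Diff_finite: "recursive_set S \<Longrightarrow> finite T \<Longrightarrow> recursive_set (S - T)"
  unfolding Diff_eq
  by (rule recursive_set_Int[OF _ recursive_set_Compl[OF recursive_set_finite]])

lemma recursive_set_vimage:
  assumes "total_recursive f" and "recursive_set S"
  shows "recursive_set (f -` S)"
  unfolding recursive_set_iff[of "f -` S"] vimage_eq
  by (rule recrel_mem[OF assms(2) recfun_app[OF assms(1) recfun_nth]]) simp

text \<open>
  The position of an argument in the increasing list of its fibre. Along a fibre the values are \<open>0, 1,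
  2, \<dots>\<close>, and unlike the size of the fibre they are computable.
\<close>

definition rank :: "(nat \<Rightarrow> nat) \<Rightarrow> nat \<Rightarrow> nat" where
  "rank f x = card {w. w < x \<and> f w = f x}"

lemma recfun_rank:
  assumes f: "total_recursive f" and a: "recfun n a"
  shows "recfun n (\<lambda>e. rank f (a e))"
proof (rule recfun_cong)
  show "recfun n (\<lambda>e. rec_nat 0 (\<lambda>i y. if f i = f (a e) then Suc y else y) (a e))"
    by (intro recfun_rec recfun_intros recfun_app[OF f] recfun_tl a) simp_all
  have "rec_nat 0 (\<lambda>i y. if f i = v then Suc y else y) m = card {w. w < m \<and> f w = v}" for v m
  proof (induction m)
    case (Suc m)
    have "{w. w < Suc m \<and> f w = v} =
        (if f m = v then insert m {w. w < m \<and> f w = v} else {w. w < m \<and> f w = v})"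
      by (auto simp: less_Suc_eq)
    then show ?case
      using Suc by simp
  qed simp
  then show "rec_nat 0 (\<lambda>i y. if f i = f (a e) then Suc y else y) (a e) = rank f (a e)" for e
    unfolding rank_def .
qed

lemma rank_less:
  assumes "f x = f y" and "x < y"
  shows "rank f x < rank f y"
  unfolding rank_def
proof (rule psubset_card_mono)
  have "x \<in> {w. w < y \<and> f w = f y}" "x \<notin> {w. w < x \<and> f w = f x}"
    using assms by simp_all
  moreover have "{w. w < x \<and> f w = f x} \<subseteq> {w. w < y \<and> f w = f y}"
    using assms by (intro Collect_mono) simp
  ultimately show "{w. w < x \<and> f w = f x} \<subset> {w. w < y \<and> f w = f y}"
    by blast
qed simp

lemma rank_inj: "f x = f y \<Longrightarrow> rank f x = rank f y \<Longrightarrow> x = y"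
  by (metis rank_less less_irrefl linorder_neqE_nat)

text \<open>
  Ranks along a fibre have no gaps: the largest smaller element of the fibre has the preceding rank.
\<close>

lemma rank_surj: "j \<le> rank f x \<Longrightarrow> \<exists>w. f w = f x \<and> rank f w = j"
proof (induction x rule: less_induct)
  case (less x)
  show ?case
  proof (cases "rank f x = j")
    case False
    let ?W = "{w. w < x \<and> f w = f x}"
    define m where "m = Max ?W"
    have "?W \<noteq> {}"
      using less.prems False unfolding rank_def by (metis card.empty le_zero_eq)
    then have m: "m < x" "f m = f x" "\<And>w. w \<in> ?W \<Longrightarrow> w \<le> m"
      using Max_in[of ?W] Max_ge[of ?W] by (simp_all add: m_def)
    have "?W = insert m {w. w < m \<and> f w = f m}"
      using m by (auto simp: le_less)
    then have "rank f x = Suc (rank f m)"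
      unfolding rank_def by simp
    then have "j \<le> rank f m"
      using less.prems False by simp
    then show ?thesis
      using less.IH[OF m(1)] m(2) by simp
  qed blast
qed


section \<open>Infinite recursive subsets\<close>

text \<open>
  Iterating a recursive function that raises its argument lists an infinite set in increasing order, and
  such a set is recursive.
\<close>

lemma iteration_enumerates_recursive_set:
  assumes F: "total_recursive F" and raises: "\<And>m. m < F m"
  obtains u where "total_recursive u" and "strict_mono u" and "recursive_set (range u)"
    and "range u \<subseteq> range F" and "\<forall>n. u (Suc n) = F (u n)"
proof -
  define u where "u = rec_nat (F 0) (\<lambda>_ y. F y)"
  have u_simps: "u 0 = F 0" "u (Suc n) = F (u n)" for n
    by (simp_all add: u_def)
  have u: "total_recursive u"
    unfolding total_recursive_iff u_def
    by (intro recfun_rec recfun_intros recfun_app[OF F]) simp_all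
  have mono: "strict_mono u"
    by (simp add: strict_mono_Suc_iff u_simps raises)
  have reach: "\<exists>n. x \<le> u n" for x
    using strict_mono_imp_increasing[OF mono] by blast
  \<comment> \<open>to test membership, look only at the first value that is not below x\<close>
  have range_iff: "x \<in> range u \<longleftrightarrow> u (LEAST n. x \<le> u n) = x" for x
  proof
    assume "x \<in> range u"
    then obtain n where "x = u n"
      by blast
    moreover have "(LEAST m. u n \<le> u m) = n"
      using mono by (intro Least_equality) (simp_all add: strict_mono_less_eq)
    ultimately show "u (LEAST n. x \<le> u n) = x"
      by simp
  next
    show "u (LEAST n. x \<le> u n) = x \<Longrightarrow> x \<in> range u"
      by (rule range_eqI[OF sym])
  qed
  have "recursive_set (range u)"
    unfolding recursive_set_iff range_iff
    by (intro recfun_intros recfun_app[OF u] recfun_Least reach) simp_all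
  moreover have "u n \<in> range F" for n
    by (cases n) (simp_all add: u_simps)
  then have "range u \<subseteq> range F"
    by blast
  moreover have "\<forall>n. u (Suc n) = F (u n)"
    by (simp add: u_simps)
  ultimately show thesis
    by (rule that[OF u mono])
qed

text \<open>
  An infinite recursively enumerable set, given as an image of a recursive set, has an infinite recursive
  subset: keep only the values that exceed all values kept before.
\<close>

lemma infinite_image_enumeration:
  assumes f: "total_recursive f" and S: "recursive_set S" and inf: "infinite (f ` S)"
  obtains u where "total_recursive u" and "strict_mono u" and "recursive_set (range u)"
    and "range u \<subseteq> f ` S"
proof -
  define P where "P m x \<longleftrightarrow> x \<in> S \<and> m < f x" for m x
  define F where "F m = f (LEAST x. P m x)" for m
  have ex: "\<exists>x. P m x" for m
  proof -
    obtain y where "m < y" "y \<in> f ` S"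
      using inf unfolding infinite_nat_iff_unbounded by blast
    then show ?thesis
      unfolding P_def by blast
  qed
  have "recfun (Suc 0) (\<lambda>e. LEAST x. P (e ! 0) x)"
    by (rule recfun_Least[OF _ ex], unfold P_def)
      (intro recfun_intros recrel_mem[OF S] recfun_app[OF f]; simp)
  then have F: "total_recursive F"
    unfolding total_recursive_iff F_def by (rule recfun_app[OF f])
  have F_prop: "P m (LEAST x. P m x)" for m
    by (rule LeastI_ex[OF ex])
  then have raises: "m < F m" for m
    by (simp add: F_def P_def)
  have F_image: "range F \<subseteq> f ` S"
    using F_prop unfolding F_def P_def by blast
  obtain u where u: "total_recursive u" "strict_mono u" "recursive_set (range u)"
      "range u \<subseteq> range F" "\<forall>n. u (Suc n) = F (u n)"
    by (rule iteration_enumerates_recursive_set[OF F raises])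
  have "range u \<subseteq> f ` S"
    using u(4) F_image by blast
  then show thesis
    by (rule that[OF u(1-3)])
qed

definition finite_one :: "(nat \<Rightarrow> nat) \<Rightarrow> bool" where
  "finite_one f \<longleftrightarrow> (\<forall>y. finite {x. f x = y})"

lemma finite_one_comp:
  assumes "finite_one f" and "finite_one g"
  shows "finite_one (\<lambda>x. g (f x))"
  unfolding finite_one_def
proof
  fix z
  have "{x. g (f x) = z} = (\<Union>y\<in>{y. g y = z}. {x. f x = y})"
    by blast
  then show "finite {x. g (f x) = z}"
    using assms by (simp add: finite_one_def)
qed

lemma finite_one_inj: "inj f \<Longrightarrow> finite_one f"
  unfolding finite_one_def
  using finite_vimageI[of "{_}" f] by (simp add: vimage_def)

lemma finite_one_image_infinite:
  assumes "finite_one f" and "infinite S"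
  shows "infinite (f ` S)"
proof
  assume "finite (f ` S)"
  moreover have "finite {x. f x = y}" for y
    using assms(1) by (simp add: finite_one_def)
  ultimately have "finite (\<Union>y\<in>f ` S. {x. f x = y})"
    by (rule finite_UN_I)
  moreover have "S \<subseteq> (\<Union>y\<in>f ` S. {x. f x = y})"
    by blast
  ultimately show False
    using assms(2) finite_subset by blast
qed

lemma finite_one_div:
  assumes "finite_one f" and "0 < d"
  shows "finite_one (\<lambda>x. f x div d)"
proof (rule finite_one_comp[OF assms(1)], unfold finite_one_def, intro allI)
  fix y
  have "{x. x div d = y} \<subseteq> {..< d * Suc y}"
    using dividend_less_times_div[OF assms(2)] by auto
  then show "finite {x. x div d = y}"
    by (rule finite_subset) simp
qed

lemma finite_one_unbounded:
  assumes p: "finite_one p" and R: "infinite R"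
  shows "\<exists>x\<in>R. m < x \<and> m < p x"
proof (rule ccontr)
  assume "\<not> ?thesis"
  then have "R \<subseteq> {..m} \<union> (\<Union>y\<in>{..m}. {x. p x = y})"
    by (auto simp: not_less)
  moreover have "finite ({..m} \<union> (\<Union>y\<in>{..m}. {x. p x = y}))"
    using p by (simp add: finite_one_def)
  ultimately show False
    using R finite_subset by blast
qed

text \<open>
  Each new element of the subset, and its image, is chosen above the preceding elements and their images; so
  an image can only meet the subset in its own preimage, that is, in a fixed point.
\<close>

lemma infinite_recursive_subset_avoiding_image:
  assumes p: "total_recursive p" "finite_one p" and R: "recursive_set R" "infinite R"
    and no_fix: "\<And>x. x \<in> R \<Longrightarrow> p x \<noteq> x"
  obtains T where "T \<subseteq> R" and "recursive_set T" and "infinite T" and "p ` T \<inter> T = {}"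
proof -
  \<comment> \<open>only the last chosen element m is bounded explicitly; those before it, with their images, are smaller\<close>
  define P where "P m x \<longleftrightarrow> x \<in> R \<and> m < x \<and> p m < x \<and> m < p x \<and> p m < p x" for m x
  define F where "F m = (LEAST x. P m x)" for m
  have ex: "\<exists>x. P m x" for m
    using finite_one_unbounded[OF p(2) R(2), of "max m (p m)"] by (auto simp: P_def)
  have F: "total_recursive F"
    unfolding total_recursive_iff F_def
    by (rule recfun_Least[OF _ ex], unfold P_def)
      (intro recfun_intros recrel_mem[OF R(1)] recfun_app[OF p(1)]; simp)
  have F_prop: "P m (F m)" for m
    unfolding F_def by (rule LeastI_ex[OF ex])
  then have raises: "m < F m" for m
    by (simp add: P_def)
  obtain u where "total_recursive u" and u: "strict_mono u" "recursive_set (range u)"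
      "range u \<subseteq> range F" "\<forall>n. u (Suc n) = F (u n)"
    by (rule iteration_enumerates_recursive_set[OF F raises])
  have sub: "range u \<subseteq> R"
  proof
    fix x assume "x \<in> range u"
    then obtain m where "x = F m"
      using u(3) by blast
    then show "x \<in> R"
      using F_prop[of m] by (simp add: P_def)
  qed
  have step: "p (u n) < u (Suc n)" "u n < p (u (Suc n))" for n
    using F_prop[of "u n"] u(4) by (simp_all add: P_def)
  have "p (u i) \<noteq> u j" for i j
  proof (cases i j rule: linorder_cases)
    case less
    then have "u (Suc i) \<le> u j"
      using u(1) by (simp add: strict_mono_less_eq)
    then show ?thesis
      using step(1)[of i] by simp
  next
    case equal
    then show ?thesis
      using no_fix sub by blast
  next
    case greater
    then obtain k where k: "i = Suc k" "j \<le> k"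
      by (cases i) auto
    then have "u j \<le> u k"
      using u(1) by (simp add: strict_mono_less_eq)
    then show ?thesis
      using step(2)[of k] k(1) by simp
  qed
  then have "p ` range u \<inter> range u = {}"
    by auto
  moreover have "infinite (range u)"
    using u(1) strict_mono_imp_inj_on finite_imageD by blast
  ultimately show thesis
    using that sub u(2) by blast
qed


section \<open>A set with few recursive self-maps\<close>

instance recf :: countable
  by countable_datatype

lemma countable_total_recursive: "countable {f. total_recursive f}"
proof -
  have "inj_on (\<lambda>f. SOME r. \<forall>x. computes r [x] (f x)) {f. total_recursive f}"
  proof (rule inj_onI)
    fix f g :: "nat \<Rightarrow> nat"
    let ?code = "\<lambda>f r. \<forall>x. computes r [x] (f x)"
    assume "f \<in> {f. total_recursive f}" "g \<in> {f. total_recursive f}"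
      and eq: "(SOME r. ?code f r) = (SOME r. ?code g r)"
    then have "\<exists>r. ?code f r" "\<exists>r. ?code g r"
      by (simp_all add: total_recursive_def)
    from this[THEN someI_ex] show "f = g"
      unfolding eq using computes_deterministic by blast
  qed
  then show ?thesis
    by (rule countableI')
qed

lemma countable_recursive_set: "countable {S. recursive_set S}"
proof (rule countable_subset)
  show "countable ((\<lambda>f. {x. f x = 1}) ` {f. total_recursive f})"
    by (rule countable_image[OF countable_total_recursive])
  show "{S. recursive_set S} \<subseteq> (\<lambda>f. {x. f x = 1}) ` {f. total_recursive f}"
  proof
    fix S :: "nat set"
    define ind where "ind x = (if x \<in> S then 1 else 0 :: nat)" for x
    assume "S \<in> {S. recursive_set S}"
    then have "ind \<in> {f. total_recursive f}"
      unfolding recursive_set_def ind_def[abs_def] by simp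
    moreover have "S = {x. ind x = 1}"
      by (simp add: ind_def)
    ultimately show "S \<in> (\<lambda>f. {x. f x = 1}) ` {f. total_recursive f}"
      by (intro image_eqI[where x = ind]) simp_all
  qed
qed

text \<open>
  A pseudo-intersection argument: meeting the dense families one after the other gives a descending sequence
  of infinite recursive sets, and a set with one element from each of them is almost contained in all of
  them.
\<close>

lemma generic_set_exists:
  fixes \<D> :: "nat set set set"
  assumes \<D>: "countable \<D>"
    and dense: "\<And>D R. D \<in> \<D> \<Longrightarrow> recursive_set R \<Longrightarrow> infinite R \<Longrightarrow>
        \<exists>T\<in>D. T \<subseteq> R \<and> recursive_set T \<and> infinite T"
  obtains C where "infinite C"
    and "\<forall>D\<in>\<D>. \<exists>R\<in>D. recursive_set R \<and> finite (C - R)"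
proof -
  \<comment> \<open>with no requirements at all, the universal family is met infinitely often\<close>
  define D where "D n = (if \<D> = {} then UNIV else from_nat_into \<D> n)" for n
  have D_dense: "\<exists>T\<in>D n. T \<subseteq> R \<and> recursive_set T \<and> infinite T"
    if "recursive_set R" "infinite R" for R n
    using dense[OF from_nat_into, of R n] that unfolding D_def by auto
  have "\<exists>R. \<forall>n. (recursive_set (R n) \<and> infinite (R n)) \<and> R (Suc n) \<subseteq> R n \<and> R (Suc n) \<in> D n"
  proof (rule dependent_nat_choice)
    have "recursive_set (- {})"
      by (intro recursive_set_Compl recursive_set_finite) simp
    then show "\<exists>R. recursive_set R \<and> infinite (R :: nat set)"
      using infinite_UNIV_nat by auto
    show "\<exists>T. (recursive_set T \<and> infinite T) \<and> T \<subseteq> R \<and> T \<in> D n"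
      if "recursive_set R \<and> infinite R" for R n
      using D_dense[of R n] that by blast
  qed
  then obtain R where R: "\<And>n. recursive_set (R n)" "\<And>n. infinite (R n)"
      "\<And>n. R (Suc n) \<subseteq> R n" "\<And>n. R (Suc n) \<in> D n"
    by blast
  have anti: "R n \<subseteq> R m" if "m \<le> n" for m n
    using R(3) that by (rule lift_Suc_antimono_le)
  have "\<exists>c. \<forall>n. c n \<in> R n \<and> c n < c (Suc n)"
  proof (rule dependent_nat_choice)
    show "\<exists>x. x \<in> R 0"
      using R(2)[of 0] by (metis ex_in_conv finite.emptyI)
    show "\<exists>y. y \<in> R (Suc n) \<and> x < y" for x n
      using R(2)[of "Suc n"] unfolding infinite_nat_iff_unbounded by blast
  qed
  then obtain c where c: "\<And>n. c n \<in> R n" "strict_mono c"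
    unfolding strict_mono_Suc_iff by blast
  have "finite (range c - R n)" for n
  proof (rule finite_subset)
    show "range c - R n \<subseteq> c ` {..<n}"
    proof
      fix x assume x: "x \<in> range c - R n"
      then obtain m where m: "x = c m"
        by blast
      then have "\<not> n \<le> m"
        using x c(1)[of m] anti[of n m] by blast
      then show "x \<in> c ` {..<n}"
        using m by simp
    qed
  qed simp
  moreover have "\<exists>n. D n = E" if "E \<in> \<D>" for E
    using from_nat_into_surj[OF \<D> that] that by (auto simp: D_def)
  ultimately have "\<forall>E\<in>\<D>. \<exists>R\<in>E. recursive_set R \<and> finite (range c - R)"
    using R(1,4) by metis
  moreover have "infinite (range c)"
    using c(2) strict_mono_imp_inj_on finite_imageD by blast
  ultimately show thesis
    by (rule that[rotated])
qed

text \<open>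
  The images \<open>f ` S\<close> below range over the recursively enumerable sets. That a decided set gets
  a recursive (not just recursively enumerable) witness \<open>R\<close> is what later lets a reduction know
  in advance that a search will succeed.
\<close>

locale rigid =
  fixes C :: "nat set"
  assumes infinite: "infinite C"
    and decides: "total_recursive f \<Longrightarrow> recursive_set S \<Longrightarrow>
      \<exists>R. recursive_set R \<and> finite (C - R) \<and> (R \<subseteq> f ` S \<or> R \<inter> f ` S = {})"
    and moves: "total_recursive p \<Longrightarrow> finite_one p \<Longrightarrow>
      \<exists>R. recursive_set R \<and> finite (C - R) \<and> ((\<forall>x\<in>R. p x = x) \<or> p ` R \<inter> R = {})"

text \<open>
  Both kinds of requirement are dense. If \<open>f ` S\<close> meets \<open>R\<close> infinitely often,
  shrink to an infinite recursive subset of the intersection; otherwise remove the finite intersection. If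
  \<open>p\<close> has infinitely many fixed points in \<open>R\<close>, keep only these; otherwise remove
  them and thin out the rest.
\<close>

lemma rigid_exists: "\<exists>C. rigid C"
proof -
  define Dec where "Dec f S = {R. R \<subseteq> f ` S \<or> R \<inter> f ` S = {}}" for f :: "nat \<Rightarrow> nat" and S
  define Mov where "Mov p = {R. (\<forall>x\<in>R. p x = x) \<or> p ` R \<inter> R = {}}" for p :: "nat \<Rightarrow> nat"
  define \<D> where "\<D> = (\<lambda>(f, S). Dec f S) ` ({f. total_recursive f} \<times> {S. recursive_set S})
      \<union> Mov ` {p. total_recursive p \<and> finite_one p}"
  have "countable {p. total_recursive p \<and> finite_one p}"
    using countable_total_recursive by (rule countable_subset[rotated]) blast
  then have count: "countable \<D>"
    unfolding \<D>_def
    using countable_total_recursive countable_recursive_set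
    by (intro countable_Un countable_image countable_SIGMA) simp_all
  have dec: "\<exists>T\<in>Dec f S. T \<subseteq> R \<and> recursive_set T \<and> infinite T"
    if f: "total_recursive f" and S: "recursive_set S" and R: "recursive_set R" "infinite R"
    for f S R
  proof (cases "finite (f ` S \<inter> R)")
    case True
    have "R - f ` S = R - (f ` S \<inter> R)"
      by blast
    then have "recursive_set (R - f ` S)" "infinite (R - f ` S)"
      using recursive_set_Diff_finite[OF R(1) True] Diff_infinite_finite[OF True R(2)] by simp_all
    then show ?thesis
      by (intro bexI[of _ "R - f ` S"]) (auto simp: Dec_def)
  next
    case False
    have eq: "f ` S \<inter> R = f ` (S \<inter> f -` R)"
      by blast
    have "recursive_set (S \<inter> f -` R)"
      by (rule recursive_set_Int[OF S recursive_set_vimage[OF f R(1)]])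
    then obtain u :: "nat \<Rightarrow> nat"
      where "total_recursive u" "strict_mono u" "recursive_set (range u)"
        "range u \<subseteq> f ` S \<inter> R"
      using False unfolding eq by (rule infinite_image_enumeration[OF f])
    moreover from this have "infinite (range u)"
      using strict_mono_imp_inj_on finite_imageD by blast
    ultimately show ?thesis
      by (intro bexI[of _ "range u"]) (auto simp: Dec_def)
  qed
  have mov: "\<exists>T\<in>Mov p. T \<subseteq> R \<and> recursive_set T \<and> infinite T"
    if p: "total_recursive p" "finite_one p" and R: "recursive_set R" "infinite R" for p R
  proof -
    have fixed: "recursive_set {x. p x = x}"
      unfolding recursive_set_iff mem_Collect_eq
      by (intro recfun_intros recfun_app[OF p(1)]) simp_all
    show ?thesis
    proof (cases "finite (R \<inter> {x. p x = x})")
      case True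
      have "recursive_set (R - R \<inter> {x. p x = x})" "infinite (R - R \<inter> {x. p x = x})"
        using recursive_set_Diff_finite[OF R(1) True] Diff_infinite_finite[OF True R(2)] .
      moreover have "p x \<noteq> x" if "x \<in> R - R \<inter> {x. p x = x}" for x
        using that by blast
      ultimately obtain T where "T \<subseteq> R - R \<inter> {x. p x = x}" "recursive_set T" "infinite T"
          "p ` T \<inter> T = {}"
        using infinite_recursive_subset_avoiding_image[OF p] by blast
      then show ?thesis
        by (intro bexI[of _ T]) (auto simp: Mov_def)
    next
      case False
      then show ?thesis
        using recursive_set_Int[OF R(1) fixed]
        by (intro bexI[of _ "R \<inter> {x. p x = x}"]) (auto simp: Mov_def)
    qed
  qed
  have dense: "\<exists>T\<in>D. T \<subseteq> R \<and> recursive_set T \<and> infinite T"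
    if "D \<in> \<D>" "recursive_set R" "infinite R" for D R
  proof -
    from that(1) consider
      (decide) f S where "total_recursive f" "recursive_set S" "D = Dec f S"
      | (move) p where "total_recursive p" "finite_one p" "D = Mov p"
      unfolding \<D>_def by blast
    then show ?thesis
      using dec[OF _ _ that(2,3)] mov[OF _ _ that(2,3)] by cases simp_all
  qed
  obtain C where C: "infinite C"
    "\<forall>D\<in>\<D>. \<exists>R\<in>D. recursive_set R \<and> finite (C - R)"
    by (rule generic_set_exists[OF count dense])
  have "rigid C"
  proof
    show "infinite C"
      by (rule C(1))
    show "\<exists>R. recursive_set R \<and> finite (C - R) \<and> (R \<subseteq> f ` S \<or> R \<inter> f ` S = {})"
      if "total_recursive f" "recursive_set S" for f S
    proof -
      have "Dec f S \<in> \<D>"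
        using that unfolding \<D>_def by blast
      from bspec[OF C(2) this] show ?thesis
        by (auto simp: Dec_def)
    qed
    show "\<exists>R. recursive_set R \<and> finite (C - R) \<and> ((\<forall>x\<in>R. p x = x) \<or> p ` R \<inter> R = {})"
      if "total_recursive p" "finite_one p" for p
    proof -
      have "Mov p \<in> \<D>"
        using that unfolding \<D>_def by blast
      from bspec[OF C(2) this] show ?thesis
        by (auto simp: Mov_def)
    qed
  qed
  then show ?thesis ..
qed


section \<open>Bounded finite-one and one-one reductions\<close>

lemma bfo_reducibleE:
  assumes "bfo_reducible A B"
  obtains f c where "total_recursive f" and "\<forall>x. x \<in> A \<longleftrightarrow> f x \<in> B" and "finite_one f"
    and "\<forall>y. card {x. f x = y} \<le> c"
proof -
  obtain f c where "many_one_reduction f A B" "\<forall>y. finite {x. f x = y} \<and> card {x. f x = y} \<le> c"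
    using assms unfolding bfo_reducible_def by blast
  then show thesis
    unfolding many_one_reduction_def by (intro that[of f c]) (simp_all add: finite_one_def)
qed

lemma one_one_reducible_imp_bfo:
  assumes "one_one_reducible A B"
  shows "bfo_reducible A B"
proof -
  obtain f where f: "many_one_reduction f A B" "inj f"
    using assms unfolding one_one_reducible_def by blast
  have "card {x. f x = y} \<le> 1" "finite {x. f x = y}" for y
    using card_vimage_inj_on_le[OF f(2), of "{y}"] finite_vimageI[OF _ f(2), of "{y}"]
    by (simp_all add: vimage_def)
  then show ?thesis
    unfolding bfo_reducible_def using f(1) by blast
qed

lemma bfo_reducible_trans:
  assumes "bfo_reducible A B" and "bfo_reducible B C"
  shows "bfo_reducible A C"
proof -
  obtain f c where f: "total_recursive f" "\<forall>x. x \<in> A \<longleftrightarrow> f x \<in> B" "finite_one f"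
      "\<forall>y. card {x. f x = y} \<le> c"
    using assms(1) by (rule bfo_reducibleE)
  obtain g d where g: "total_recursive g" "\<forall>x. x \<in> B \<longleftrightarrow> g x \<in> C" "finite_one g"
      "\<forall>y. card {x. g x = y} \<le> d"
    using assms(2) by (rule bfo_reducibleE)
  have "card {x. g (f x) = z} \<le> d * c" for z
  proof -
    have "{x. g (f x) = z} = (\<Union>y\<in>{y. g y = z}. {x. f x = y})"
      by blast
    also have "card \<dots> \<le> (\<Sum>y\<in>{y. g y = z}. card {x. f x = y})"
      using g(3) by (intro card_UN_le) (simp add: finite_one_def)
    also have "\<dots> \<le> card {y. g y = z} * c"
      using f(4) by (intro sum_bounded_above[where K = c, simplified]) simp
    also have "\<dots> \<le> d * c"
      using g(4) by simp
    finally show ?thesis .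
  qed
  moreover have "many_one_reduction (\<lambda>x. g (f x)) A C"
    unfolding many_one_reduction_def using f g total_recursive_comp by simp
  ultimately show ?thesis
    unfolding bfo_reducible_def using finite_one_comp[OF f(3) g(3)] unfolding finite_one_def by blast
qed

lemma recursive_set_reduction:
  assumes "recursive_set B" and "many_one_reduction f A B"
  shows "recursive_set A"
proof -
  have "A = f -` B"
    using assms(2) unfolding many_one_reduction_def by blast
  then show ?thesis
    using assms recursive_set_vimage unfolding many_one_reduction_def by simp
qed

lemma one_one_degree_eqI:
  "one_one_reducible A B \<Longrightarrow> one_one_reducible B A \<Longrightarrow> one_one_degree A = one_one_degree B"
  unfolding one_one_degree_def using one_one_reducible_trans by blast


section \<open>Several copies of a set\<close>

text \<open>
  Numbers are read as pairs of a quotient and a digit below \<open>k + 2\<close>. The digits below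
  \<open>k\<close> carry the copies of \<open>C\<close>; the digits \<open>k\<close> and \<open>k +
  1\<close> carry \<open>\<nat>\<close> and \<open>{}\<close>, which give reductions room for arguments
  whose membership is known and so absorb finite differences.
\<close>

definition copies :: "nat \<Rightarrow> nat set \<Rightarrow> nat set" where
  "copies k C = {x. x mod (k + 2) < k \<and> x div (k + 2) \<in> C \<or> x mod (k + 2) = k}"

lemma digits:
  fixes a i d :: nat
  assumes "i < d"
  shows "(d * a + i) mod d = i" and "(d * a + i) div d = a"
  using assms by simp_all

lemma copies_iff:
  assumes "i < k + 2"
  shows "(k + 2) * a + i \<in> copies k C \<longleftrightarrow> i < k \<and> a \<in> C \<or> i = k"
  unfolding copies_def mem_Collect_eq digits[OF assms] ..

lemma copies_1_iff: "x \<in> copies 1 C \<longleftrightarrow> x mod 3 = 0 \<and> x div 3 \<in> C \<or> x mod 3 = 1"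
proof -
  have "1 + 2 = (3 :: nat)" "y < 1 \<longleftrightarrow> y = 0" for y :: nat
    by simp_all
  then show ?thesis
    unfolding copies_def mem_Collect_eq by simp
qed

lemma eq_times_3_iff: "y = 3 * a \<longleftrightarrow> y mod 3 = 0 \<and> y div 3 = a" for a y :: nat
  by presburger

lemma digits_eq_iff:
  fixes a b i j d :: nat
  assumes "i < d" and "j < d"
  shows "d * a + i = d * b + j \<longleftrightarrow> a = b \<and> i = j"
proof
  assume eq: "d * a + i = d * b + j"
  have "a = b"
    using digits(2)[OF assms(1), of a] unfolding eq digits(2)[OF assms(2)] by (rule sym)
  moreover have "i = j"
    using digits(1)[OF assms(1), of a] unfolding eq digits(1)[OF assms(2)] by (rule sym)
  ultimately show "a = b \<and> i = j" ..
qed simp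

lemma one_one_reducible_copies:
  assumes "k \<le> j"
  shows "one_one_reducible (copies k C) (copies j C)"
proof -
  define s where "s i = (if i < k then i else if i = k then j else j + 1)" for i
  define f where "f x = (j + 2) * (x div (k + 2)) + s (x mod (k + 2))" for x
  have s: "s i < j + 2" for i
    using assms by (simp add: s_def)
  have "total_recursive f"
    unfolding total_recursive_iff f_def s_def by (intro recfun_intros) simp_all
  moreover have "x \<in> copies k C \<longleftrightarrow> f x \<in> copies j C" for x
    unfolding f_def copies_iff[OF s] copies_def[of k] mem_Collect_eq
    using assms by (simp add: s_def)
  moreover have "inj f"
  proof (rule injI)
    fix x y
    assume "f x = f y"
    then have div: "x div (k + 2) = y div (k + 2)" and s_mod: "s (x mod (k + 2)) = s (y mod (k + 2))"
      unfolding f_def digits_eq_iff[OF s s] by blast+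
    have "i = i'" if "s i = s i'" "i < k + 2" "i' < k + 2" for i i'
      using that assms by (auto simp: s_def split: if_splits)
    from this[OF s_mod] have "x mod (k + 2) = y mod (k + 2)"
      by simp
    with div have "(k + 2) * (x div (k + 2)) + x mod (k + 2) =
        (k + 2) * (y div (k + 2)) + y mod (k + 2)"
      by simp
    then show "x = y"
      unfolding mult_div_mod_eq .
  qed
  ultimately show ?thesis
    unfolding one_one_reducible_def many_one_reduction_def by blast
qed

lemma copies_bfo_reducible_copies_1:
  assumes "1 \<le> k"
  shows "bfo_reducible (copies k C) (copies 1 C)"
proof -
  define s where "s i = (if i < k then 0 else if i = k then 1 else 2 :: nat)" for i
  define f where "f x = 3 * (x div (k + 2)) + s (x mod (k + 2))" for x
  have s: "s i < 3" for i
    by (simp add: s_def)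
  have "total_recursive f"
    unfolding total_recursive_iff f_def s_def by (intro recfun_intros) simp_all
  moreover have "x \<in> copies k C \<longleftrightarrow> f x \<in> copies 1 C" for x
    unfolding f_def copies_1_iff digits[OF s] copies_def mem_Collect_eq
    using assms by (simp add: s_def)
  moreover have "finite {x. f x = y} \<and> card {x. f x = y} \<le> k + 2" for y
  proof -
    have sub: "{x. f x = y} \<subseteq> (\<lambda>i. (k + 2) * (y div 3) + i) ` {..<k + 2}"
    proof
      fix x assume "x \<in> {x. f x = y}"
      then have "y = 3 * (x div (k + 2)) + s (x mod (k + 2))"
        by (simp only: f_def mem_Collect_eq)
      then have "y div 3 = x div (k + 2)"
        using digits(2)[OF s] by simp
      then have "x = (k + 2) * (y div 3) + x mod (k + 2)"
        by (simp only: mult_div_mod_eq)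
      then show "x \<in> (\<lambda>i. (k + 2) * (y div 3) + i) ` {..<k + 2}"
        by (rule image_eqI) simp
    qed
    have "finite {x. f x = y}"
      using sub by (rule finite_subset) simp
    moreover have "card {x. f x = y} \<le> k + 2"
      using surj_card_le[OF _ sub] by simp
    ultimately show ?thesis ..
  qed
  ultimately show ?thesis
    unfolding bfo_reducible_def many_one_reduction_def by blast
qed


section \<open>The chain of copies of a rigid set\<close>

context rigid
begin

lemma infinite_Int_of_almost_subset: "finite (C - R) \<Longrightarrow> infinite (C \<inter> R)"
  using infinite by (metis Int_Diff_Un finite_UnI)

text \<open>
  The map to the next element of a recursive set \<open>S\<close> has no fixed points, so it moves some
  recursive \<open>R\<close> with \<open>C \<subseteq>\<^sup>* R\<close> off itself. If \<open>S\<close>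
  were an infinite subset of \<open>C\<close>, almost all of \<open>S\<close> would lie in \<open>R\<close>
  together with its successors.
\<close>

lemma recursive_subset_finite:
  assumes S: "recursive_set S" and sub: "S \<subseteq> C"
  shows "finite S"
proof (rule ccontr)
  assume inf: "infinite S"
  define p where "p x = (LEAST y. y \<in> S \<and> x < y)" for x
  have ex: "\<exists>y. y \<in> S \<and> x < y" for x
    using inf unfolding infinite_nat_iff_unbounded by blast
  have p: "total_recursive p"
    unfolding total_recursive_iff p_def
    by (rule recfun_Least[OF _ ex]) (intro recfun_intros recrel_mem[OF S]; simp)
  have p_prop: "p x \<in> S" "x < p x" for x
    using LeastI_ex[OF ex[of x]] by (simp_all add: p_def)
  have "{x. p x = y} \<subseteq> {..<y}" for y
    using p_prop(2) by blast
  then have "finite_one p"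
    unfolding finite_one_def using finite_subset by blast
  with p obtain R where R: "finite (C - R)" "(\<forall>x\<in>R. p x = x) \<or> p ` R \<inter> R = {}"
    using moves by blast
  obtain x where "x \<in> R"
    using infinite_Int_of_almost_subset[OF R(1)] by (metis IntE finite.emptyI ex_in_conv)
  then have disj: "p ` R \<inter> R = {}"
    using R(2) p_prop(2)[of x] by (metis less_irrefl)
  have "finite (S - R)"
    using R(1) sub by (rule rev_finite_subset[OF _ Diff_mono]) simp
  then obtain m where m: "\<And>x. x \<in> S - R \<Longrightarrow> x \<le> m"
    unfolding finite_nat_set_iff_bounded_le by blast
  obtain x where x: "x \<in> S" "m < x"
    using ex by blast
  then have "x \<in> R" "p x \<in> R"
    using m[of x] m[of "p x"] p_prop[of x] by force+
  then show False
    using disj by blast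
qed

lemma not_recursive: "\<not> recursive_set C"
  using recursive_subset_finite infinite by blast

text \<open>
  Arguments sent to the copy of \<open>\<nat>\<close> form a recursive subset of \<open>C\<close>, so they
  are finitely many, and no element of \<open>C\<close> is sent to the copy of \<open>{}\<close>. Thus the
  quotient maps almost all of \<open>C\<close> into \<open>C\<close>; if it moved some \<open>R\<close> with
  \<open>C \<subseteq>\<^sup>* R\<close> off itself, it would map infinitely many elements of
  \<open>C\<close> into the finite set \<open>C - R\<close>.
\<close>

lemma self_reduction_almost_identity:
  assumes q: "total_recursive q" "finite_one q"
    and red: "\<And>c. c \<in> C \<longleftrightarrow> q c \<in> copies k C"
  shows "finite {c \<in> C. \<not> (q c mod (k + 2) < k \<and> q c div (k + 2) = c)}"
proof -
  have "recursive_set {c. q c mod (k + 2) = k}"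
    unfolding recursive_set_iff mem_Collect_eq
    by (intro recfun_intros recfun_app[OF q(1)]) simp_all
  moreover have "{c. q c mod (k + 2) = k} \<subseteq> C"
    using red by (auto simp: copies_def)
  ultimately have fin_in: "finite {c. q c mod (k + 2) = k}"
    by (rule recursive_subset_finite)
  have in_or: "q c mod (k + 2) < k \<and> q c div (k + 2) \<in> C" if "c \<in> C" "q c mod (k + 2) \<noteq> k" for c
    using that red[of c] unfolding copies_def by simp
  define p where "p c = q c div (k + 2)" for c
  have "total_recursive p"
    unfolding total_recursive_iff p_def by (intro recfun_intros recfun_app[OF q(1)]) simp_all
  moreover have p: "finite_one p"
    unfolding p_def by (rule finite_one_div[OF q(2)]) simp
  ultimately obtain R where R: "finite (C - R)" "(\<forall>x\<in>R. p x = x) \<or> p ` R \<inter> R = {}"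
    using moves by blast
  have "p ` R \<inter> R \<noteq> {}"
  proof
    assume disj: "p ` R \<inter> R = {}"
    define T where "T = C \<inter> R - {c. q c mod (k + 2) = k}"
    have "infinite T"
      unfolding T_def by (rule Diff_infinite_finite[OF fin_in infinite_Int_of_almost_subset[OF R(1)]])
    then have "infinite (p ` T)"
      by (rule finite_one_image_infinite[OF p])
    moreover have "p ` T \<subseteq> C - R"
      using disj in_or unfolding T_def p_def by blast
    ultimately show False
      using R(1) finite_subset by blast
  qed
  then have "\<forall>x\<in>R. p x = x"
    using R(2) by blast
  then have "{c \<in> C. \<not> (q c mod (k + 2) < k \<and> q c div (k + 2) = c)} \<subseteq>
      (C - R) \<union> {c. q c mod (k + 2) = k}"
    using in_or unfolding p_def by blast
  then show ?thesis
    using R(1) fin_in finite_subset by blast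
qed

text \<open>
  For almost every \<open>c\<close> in \<open>C\<close>, an injective reduction must send the
  \<open>k\<close> copies of \<open>c\<close> to the \<open>j\<close> copies of the same \<open>c\<close>.
\<close>

lemma one_one_reducible_copies_iff:
  "one_one_reducible (copies k C) (copies j C) \<longleftrightarrow> k \<le> j"
proof
  assume "one_one_reducible (copies k C) (copies j C)"
  then obtain f where f: "total_recursive f" "\<forall>x. x \<in> copies k C \<longleftrightarrow> f x \<in> copies j C" "inj f"
    unfolding one_one_reducible_def many_one_reduction_def by blast
  define q where "q i c = f ((k + 2) * c + i)" for i c
  define bad where "bad i = {c \<in> C. \<not> (q i c mod (j + 2) < j \<and> q i c div (j + 2) = c)}" for i
  have "finite (bad i)" if "i < k" for i
    unfolding bad_def
  proof (rule self_reduction_almost_identity)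
    show "total_recursive (q i)"
      unfolding total_recursive_iff q_def by (intro recfun_intros recfun_app[OF f(1)]) simp_all
    have "inj (q i)"
    proof (rule injI)
      fix x y assume "q i x = q i y"
      then have "(k + 2) * x + i = (k + 2) * y + i"
        unfolding q_def by (rule injD[OF f(3)])
      then have "(k + 2) * x = (k + 2) * y"
        by (rule add_right_imp_eq)
      then show "x = y"
        unfolding mult_cancel1 by simp
    qed
    then show "finite_one (q i)"
      by (rule finite_one_inj)
    have "i < k + 2"
      using that by simp
    from copies_iff[OF this, of _ C] have "c \<in> C \<longleftrightarrow> (k + 2) * c + i \<in> copies k C" for c
      using that by blast
    then show "c \<in> C \<longleftrightarrow> q i c \<in> copies j C" for c
      unfolding q_def by (rule trans[OF _ spec[OF f(2)]])
  qed
  then have "finite (\<Union>i<k. bad i)"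
    by simp
  then have "infinite (C - (\<Union>i<k. bad i))"
    using infinite by (rule Diff_infinite_finite)
  then obtain c where "c \<in> C - (\<Union>i<k. bad i)"
    by (metis ex_in_conv finite.emptyI)
  then have c: "c \<in> C" "\<And>i. i < k \<Longrightarrow> c \<notin> bad i"
    by simp_all
  have q: "q i c mod (j + 2) < j" "q i c div (j + 2) = c" if "i < k" for i
    using c(1) c(2)[OF that] unfolding bad_def by blast+
  have "inj_on (\<lambda>i. q i c mod (j + 2)) {..<k}"
  proof (rule inj_onI)
    fix i i' assume i: "i \<in> {..<k}" "i' \<in> {..<k}" "q i c mod (j + 2) = q i' c mod (j + 2)"
    then have "(j + 2) * (q i c div (j + 2)) + q i c mod (j + 2) =
        (j + 2) * (q i' c div (j + 2)) + q i' c mod (j + 2)"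
      by (simp only: q(2) lessThan_iff)
    then have "q i c = q i' c"
      unfolding mult_div_mod_eq .
    then show "i = i'"
      unfolding q_def using injD[OF f(3)] add_left_imp_eq by blast
  qed
  moreover have "(\<lambda>i. q i c mod (j + 2)) ` {..<k} \<subseteq> {..<j}"
    using q(1) by blast
  ultimately show "k \<le> j"
    using card_inj_on_le[of _ "{..<k}" "{..<j}"] by simp
qed (rule one_one_reducible_copies)


section \<open>The sets in the bounded finite-one degree\<close>

text \<open>
  The set of elements whose copy has an \<open>f\<close>-preimage of rank at least \<open>j\<close> is
  recursively enumerable and shrinks as \<open>j\<close> grows. It contains almost all of \<open>C\<close>
  for \<open>j = 0\<close>, because \<open>g\<close> followed by \<open>f\<close> is almost the identity,
  and it is empty once \<open>j\<close> reaches the bound \<open>b\<close>. So \<open>C\<close> leaves it at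
  a unique step; the multiplicity found is \<open>Suc k\<close>.
\<close>

lemma almost_constant_multiplicity:
  assumes f: "total_recursive f" "finite_one f" "\<forall>x. x \<in> B \<longleftrightarrow> f x \<in> copies 1 C"
      "\<forall>y. card {x. f x = y} \<le> b"
    and g: "total_recursive g" "finite_one g" "\<forall>x. x \<in> copies 1 C \<longleftrightarrow> g x \<in> B"
  obtains k R where "recursive_set R" and "finite (C - R)"
    and "\<forall>a\<in>R. \<forall>j<Suc k. \<exists>x. f x = 3 * a \<and> rank f x = j"
    and "finite {a \<in> C. \<exists>x. f x = 3 * a \<and> Suc k \<le> rank f x}"
proof -
  define W where "W j = {a. \<exists>x. f x = 3 * a \<and> j \<le> rank f x}" for j
  have decide: "\<exists>R. recursive_set R \<and> finite (C - R) \<and> (R \<subseteq> W j \<or> R \<inter> W j = {})" for j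
  proof -
    have rec: "recursive_set {x. f x mod 3 = 0 \<and> j \<le> rank f x}"
      unfolding recursive_set_iff mem_Collect_eq
      by (intro recfun_intros recfun_app[OF f(1)] recfun_rank[OF f(1)]) simp_all
    have tot: "total_recursive (\<lambda>x. f x div 3)"
      unfolding total_recursive_iff by (intro recfun_intros recfun_app[OF f(1)]) simp_all
    have image: "(\<lambda>x. f x div 3) ` {x. f x mod 3 = 0 \<and> j \<le> rank f x} = W j"
    proof (intro set_eqI iffI)
      fix a assume "a \<in> W j"
      then obtain x where "f x = 3 * a" "j \<le> rank f x"
        unfolding W_def by blast
      then show "a \<in> (\<lambda>x. f x div 3) ` {x. f x mod 3 = 0 \<and> j \<le> rank f x}"
        by (intro image_eqI[of _ _ x]) simp_all
    next
      fix a assume "a \<in> (\<lambda>x. f x div 3) ` {x. f x mod 3 = 0 \<and> j \<le> rank f x}"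
      then obtain x where "a = f x div 3" "x \<in> {x. f x mod 3 = 0 \<and> j \<le> rank f x}"
        by (rule imageE)
      then have "f x = 3 * a" "j \<le> rank f x"
        unfolding eq_times_3_iff by simp_all
      then show "a \<in> W j"
        unfolding W_def by blast
    qed
    show ?thesis
      using decides[OF tot rec] unfolding image .
  qed
  have "W b = {}"
  proof -
    have "rank f x < b" for x
    proof -
      have "rank f x < card {w. f w = f x}"
        unfolding rank_def
      proof (rule psubset_card_mono)
        show "finite {w. f w = f x}"
          using f(2) by (simp add: finite_one_def)
        have "x \<in> {w. f w = f x}" "x \<notin> {w. w < x \<and> f w = f x}"
          by simp_all
        then show "{w. w < x \<and> f w = f x} \<subset> {w. f w = f x}"
          by blast
      qed
      then show ?thesis
        using f(4) by (meson less_le_trans)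
    qed
    then show ?thesis
      unfolding W_def by (simp add: not_le)
  qed
  then have ex: "\<exists>j. finite (C \<inter> W j)"
    by (intro exI[of _ b]) simp
  define l where "l = (LEAST j. finite (C \<inter> W j))"
  have fin: "finite (C \<inter> W l)"
    unfolding l_def by (rule LeastI_ex[OF ex])
  have "infinite (C \<inter> W 0)"
  proof -
    let ?q = "\<lambda>c. f (g (3 * c))"
    \<comment> \<open>q sends almost every c to its own copy, so that copy is a value of f\<close>
    have "finite {c \<in> C. \<not> (?q c mod (1 + 2) < 1 \<and> ?q c div (1 + 2) = c)}"
    proof (rule self_reduction_almost_identity)
      have t: "total_recursive (\<lambda>c. 3 * c)"
        unfolding total_recursive_iff by (intro recfun_intros) simp_all
      show "total_recursive ?q"
        using total_recursive_comp[OF total_recursive_comp[OF t g(1)] f(1)] .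
      have "finite_one (\<lambda>c. 3 * c)"
        by (rule finite_one_inj) (simp add: inj_def)
      then show "finite_one ?q"
        by (intro finite_one_comp[OF finite_one_comp[OF _ g(2)] f(2)])
      show "c \<in> C \<longleftrightarrow> ?q c \<in> copies 1 C" for c
      proof -
        have "c \<in> C \<longleftrightarrow> 3 * c \<in> copies 1 C"
          unfolding copies_1_iff by simp
        also have "\<dots> \<longleftrightarrow> ?q c \<in> copies 1 C"
          using f(3) g(3) by blast
        finally show ?thesis .
      qed
    qed
    moreover have "C - W 0 \<subseteq>
        {c \<in> C. \<not> (?q c mod (1 + 2) < 1 \<and> ?q c div (1 + 2) = c)}"
    proof
      fix c assume c: "c \<in> C - W 0"
      have eq: "y = 3 * c" if "y mod (1 + 2) < 1 \<and> y div (1 + 2) = c" for y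
        using that unfolding eq_times_3_iff by simp
      have "?q c \<noteq> 3 * c"
        using c unfolding W_def by blast
      then have "\<not> (?q c mod (1 + 2) < 1 \<and> ?q c div (1 + 2) = c)"
        by (rule contrapos_nn) (rule eq)
      with c show "c \<in> {c \<in> C. \<not> (?q c mod (1 + 2) < 1 \<and> ?q c div (1 + 2) = c)}"
        using c by blast
    qed
    ultimately have "finite (C - W 0)"
      by (rule finite_subset[rotated])
    then show ?thesis
      by (rule infinite_Int_of_almost_subset)
  qed
  then have "l \<noteq> 0"
    using fin by (intro notI) simp
  then obtain k where k: "l = Suc k"
    by (cases l) auto
  have inf: "infinite (C \<inter> W k)"
    using not_less_Least[of k "\<lambda>j. finite (C \<inter> W j)"] k unfolding l_def by simp
  obtain R where R: "recursive_set R" "finite (C - R)" "R \<subseteq> W k \<or> R \<inter> W k = {}"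
    using decide by blast
  have sub: "R \<subseteq> W k"
  proof (rule ccontr)
    assume "\<not> R \<subseteq> W k"
    then have "C \<inter> W k \<subseteq> C - R"
      using R(3) by blast
    then show False
      using inf R(2) finite_subset by blast
  qed
  have mult: "\<forall>a\<in>R. \<forall>j<Suc k. \<exists>x. f x = 3 * a \<and> rank f x = j"
  proof (intro ballI allI impI)
    fix a j assume "a \<in> R" and j: "j < Suc k"
    then obtain x where x: "f x = 3 * a" "k \<le> rank f x"
      using sub unfolding W_def by blast
    then have "j \<le> rank f x"
      using j by simp
    then show "\<exists>x. f x = 3 * a \<and> rank f x = j"
      unfolding x(1)[symmetric] by (rule rank_surj)
  qed
  have eq: "{a \<in> C. \<exists>x. f x = 3 * a \<and> Suc k \<le> rank f x} = C \<inter> W l"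
    unfolding W_def k by blast
  show thesis
    by (rule that[OF R(1,2) mult fin[folded eq]])
qed


text \<open>
  An argument \<open>x\<close> of rank below \<open>k\<close> over the copy of \<open>a\<close> goes to the
  copy of \<open>a\<close> numbered by that rank. Any other \<open>x\<close> lies over one of the recursive
  parts, or has rank at least \<open>k\<close> and is outside \<open>B\<close> with finitely many
  exceptions; it goes to place \<open>x\<close> of the copy of \<open>\<nat>\<close> or of
  \<open>{}\<close>.
\<close>

lemma reducible_to_copies_of_multiplicity:
  assumes f: "total_recursive f" "finite_one f" "\<forall>x. x \<in> B \<longleftrightarrow> f x \<in> copies 1 C"
    and fin: "finite {a \<in> C. \<exists>x. f x = 3 * a \<and> k \<le> rank f x}"
  shows "one_one_reducible B (copies k C)"
proof -
  \<comment> \<open>the exceptional arguments: all of them belong to B\<close>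
  define E where "E = {x. \<exists>a. f x = 3 * a \<and> a \<in> C \<and> k \<le> rank f x}"
  have "E \<subseteq> (\<Union>a\<in>{a \<in> C. \<exists>x. f x = 3 * a \<and> k \<le> rank f x}. {x. f x = 3 * a})"
    unfolding E_def by blast
  moreover have "finite (\<Union>a\<in>{a \<in> C. \<exists>x. f x = 3 * a \<and> k \<le> rank f x}. {x. f x = 3 * a})"
    using fin f(2) by (simp add: finite_one_def)
  ultimately have "finite E"
    by (rule finite_subset)
  then have E: "recursive_set E"
    by (rule recursive_set_finite)
  define kept where "kept x \<longleftrightarrow> f x mod 3 = 0 \<and> rank f x < k" for x
  define a where "a x = (if kept x then f x div 3 else x)" for x
  define i where "i x = (if kept x then rank f x else if x \<in> E \<or> f x mod 3 = 1 then k else k + 1)" for x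
  have i: "i x < k + 2" for x
    by (simp add: i_def kept_def)
  define h where "h x = (k + 2) * a x + i x" for x
  have "total_recursive h"
    unfolding total_recursive_iff h_def a_def i_def kept_def
    by (intro recfun_intros recfun_app[OF f(1)] recfun_rank[OF f(1)] recrel_mem[OF E]) simp_all
  moreover have "x \<in> B \<longleftrightarrow> h x \<in> copies k C" for x
  proof -
    have B: "x \<in> B \<longleftrightarrow> f x mod 3 = 0 \<and> f x div 3 \<in> C \<or> f x mod 3 = 1"
      unfolding copies_1_iff[symmetric] using f(3) by blast
    have E_iff: "x \<in> E \<longleftrightarrow> f x mod 3 = 0 \<and> f x div 3 \<in> C \<and> k \<le> rank f x"
      unfolding E_def eq_times_3_iff by auto
    show ?thesis
    proof (cases "kept x")
      case True
      then show ?thesis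
        unfolding h_def copies_iff[OF i] B by (simp add: kept_def a_def i_def)
    next
      case False
      then show ?thesis
        unfolding h_def copies_iff[OF i] B unfolding i_def E_iff by (auto simp: kept_def)
    qed
  qed
  moreover have "inj h"
  proof (rule injI)
    fix x y assume "h x = h y"
    then have a: "a x = a y" and i: "i x = i y"
      unfolding h_def digits_eq_iff[OF i i] by blast+
    have i_kept: "i z < k \<longleftrightarrow> kept z" for z
      by (simp add: i_def kept_def)
    have "kept x \<longleftrightarrow> kept y"
      unfolding i_kept[symmetric] i ..
    moreover have "x = y" if "kept x" "kept y"
    proof (rule rank_inj[of f])
      show "rank f x = rank f y"
        using i that by (simp add: i_def)
      have "f x = 3 * a x" "f y = 3 * a y"
        unfolding eq_times_3_iff using that by (simp_all add: a_def kept_def)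
      then show "f x = f y"
        using a by simp
    qed
    moreover have "x = y" if "\<not> kept x" "\<not> kept y"
      using a that by (simp add: a_def)
    ultimately show "x = y"
      by blast
  qed
  ultimately show ?thesis
    unfolding one_one_reducible_def many_one_reduction_def by blast
qed

text \<open>
  A copy of \<open>a\<close> with \<open>a \<in> R\<close> goes to the element of the fibre over
  \<open>a\<close> with the rank given by its digit; the search for it ends because \<open>a\<close> is in
  \<open>R\<close>. For all other arguments membership is known, up to the finite set \<open>C - R\<close>,
  and they are sent injectively into a recursive set \<open>range u\<close> inside \<open>B\<close> or
  \<open>range v\<close> outside \<open>B\<close>.
\<close>

lemma copies_of_multiplicity_reducible:
  assumes f: "total_recursive f" "\<forall>x. x \<in> B \<longleftrightarrow> f x \<in> copies 1 C"
    and g: "total_recursive g" "finite_one g" "\<forall>x. x \<in> copies 1 C \<longleftrightarrow> g x \<in> B"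
    and R: "recursive_set R" "finite (C - R)"
    and mult: "\<forall>a\<in>R. \<forall>j<k. \<exists>x. f x = 3 * a \<and> rank f x = j"
  shows "one_one_reducible (copies k C) B"
proof -
  have residue: "infinite (g ` {x. x mod 3 = j})" "recursive_set {x. x mod 3 = j}" if "j < 3" for j
  proof -
    have "(3 * m + j) mod 3 = j" for m
      using that by simp
    then have "range (\<lambda>m. 3 * m + j) \<subseteq> {x. x mod 3 = j}"
      by blast
    moreover have "infinite (range (\<lambda>m. 3 * m + j))"
      by (rule range_inj_infinite) (simp add: inj_def)
    ultimately show "infinite (g ` {x. x mod 3 = j})"
      using finite_one_image_infinite[OF g(2)] finite_subset by blast
    show "recursive_set {x. x mod 3 = j}"
      unfolding recursive_set_iff mem_Collect_eq by (intro recfun_intros) simp_all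
  qed
  obtain u where u: "total_recursive u" "strict_mono u" "recursive_set (range u)"
      "range u \<subseteq> g ` {x. x mod 3 = 1}"
    by (rule infinite_image_enumeration[OF g(1) residue(2,1)[of 1]]) simp_all
  obtain v where v: "total_recursive v" "strict_mono v" "recursive_set (range v)"
      "range v \<subseteq> g ` {x. x mod 3 = 2}"
    by (rule infinite_image_enumeration[OF g(1) residue(2,1)[of 2]]) simp_all
  have g_iff: "g x \<in> B \<longleftrightarrow> x mod 3 = 0 \<and> x div 3 \<in> C \<or> x mod 3 = 1" for x
    unfolding copies_1_iff[symmetric] using g(3) by blast
  have "g ` {x. x mod 3 = 1} \<subseteq> B" "g ` {x. x mod 3 = 2} \<subseteq> - B"
    by (auto simp: g_iff)
  from this[THEN order_trans[rotated]] u(4) v(4)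
  have u_B: "range u \<subseteq> B" and v_B: "range v \<subseteq> - B"
    by simp_all
  define E where "E = C - R"
  have E: "recursive_set E"
    unfolding E_def by (rule recursive_set_finite[OF R(2)])
  define a where "a y = y div (k + 2)" for y
  define i where "i y = y mod (k + 2)" for y
  define good where "good y \<longleftrightarrow> i y < k \<and> a y \<in> R" for y
  \<comment> \<open>the disjunct for arguments that are not good only makes the search total\<close>
  define z where "z y = (LEAST x. \<not> good y \<or> f x = 3 * a y \<and> rank f x = i y)" for y
  \<comment> \<open>a search result inside one of the two ranges would collide with them, but it reveals membership\<close>
  define direct where "direct y \<longleftrightarrow> good y \<and> z y \<notin> range u \<and> z y \<notin> range v" for y
  define inn where "inn y \<longleftrightarrow>
      good y \<and> z y \<in> range u \<or> \<not> good y \<and> (i y = k \<or> i y < k \<and> a y \<in> E)" for y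
  define h where "h y = (if direct y then z y else if inn y then u y else v y)" for y
  have ex: "\<exists>x. \<not> good y \<or> f x = 3 * a y \<and> rank f x = i y" for y
    using mult unfolding good_def by blast
  have z: "f (z y) = 3 * a y" "rank f (z y) = i y" if "good y" for y
    using LeastI_ex[OF ex[of y]] that unfolding z_def by blast+
  have tot_a: "total_recursive a" and tot_i: "total_recursive i"
    unfolding total_recursive_iff a_def i_def by (intro recfun_intros; simp)+
  have good: "recrel n (\<lambda>e. good (b e))" if "recfun n b" for n b
    unfolding good_def
    by (intro recfun_intros recrel_mem[OF R(1)] recfun_app[OF tot_a] recfun_app[OF tot_i] that)
  have tot_z: "total_recursive z"
    unfolding total_recursive_iff z_def
    by (rule recfun_Least[OF _ ex])
      (intro recfun_intros good recfun_app[OF f(1)] recfun_rank[OF f(1)]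
        recfun_app[OF tot_a] recfun_app[OF tot_i]; simp)
  have "total_recursive h"
    unfolding total_recursive_iff h_def direct_def inn_def
    by (intro recfun_intros good recrel_mem[OF u(3)] recrel_mem[OF v(3)] recrel_mem[OF E]
        recfun_app[OF tot_z] recfun_app[OF tot_a] recfun_app[OF tot_i]
        recfun_app[OF u(1)] recfun_app[OF v(1)]; simp)
  moreover have "y \<in> copies k C \<longleftrightarrow> h y \<in> B" for y
  proof -
    have y: "y \<in> copies k C \<longleftrightarrow> i y < k \<and> a y \<in> C \<or> i y = k"
      unfolding copies_def a_def i_def by blast
    have uv: "u y \<in> B" "v y \<notin> B"
      using u_B v_B by blast+
    show ?thesis
    proof (cases "good y")
      case True
      have "z y \<in> B \<longleftrightarrow> a y \<in> C"
        unfolding spec[OF f(2)] z(1)[OF True] copies_1_iff by simp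
      then have "y \<in> copies k C \<longleftrightarrow> z y \<in> B"
        unfolding y using True unfolding good_def by simp
      then show ?thesis
        using True uv u_B v_B unfolding h_def direct_def inn_def by auto
    next
      case False
      then have "y \<in> copies k C \<longleftrightarrow> inn y"
        unfolding y inn_def E_def good_def by blast
      then show ?thesis
        using False uv unfolding h_def direct_def by simp
    qed
  qed
  moreover have "inj h"
  proof (rule injI)
    fix x y assume eq: "h x = h y"
    have disj: "u x' \<noteq> v y'" for x' y'
      using u_B v_B by (metis ComplD rangeI subsetD)
    have off: "z x' \<noteq> u y'" "z x' \<noteq> v y'" if "direct x'" for x' y'
      using that unfolding direct_def by auto
    have inj_u: "u x = u y \<longleftrightarrow> x = y" and inj_v: "v x = v y \<longleftrightarrow> x = y"
      using u(2) v(2) by (simp_all add: strict_mono_eq)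
    show "x = y"
    proof (cases "direct x \<and> direct y")
      case True
      then have "z x = z y" "good x" "good y"
        using eq unfolding h_def direct_def by simp_all
      then have "a x = a y" "i x = i y"
        using z[of x] z[of y] by simp_all
      then have "(k + 2) * a x + i x = (k + 2) * a y + i y"
        by simp
      then show ?thesis
        unfolding a_def i_def mult_div_mod_eq .
    next
      case False
      then have "\<not> direct x" "\<not> direct y"
        using eq off[of x] off[of y] off[of y, symmetric] unfolding h_def
        by (auto split: if_splits)
      then show ?thesis
        using eq disj[of x y] disj[of y x] inj_u inj_v unfolding h_def
        by (auto split: if_splits)
    qed
  qed
  ultimately show ?thesis
    unfolding one_one_reducible_def many_one_reduction_def by blast
qed

lemma bfo_degree_classification:
  "B \<in> bfo_degree (copies 1 C) \<longleftrightarrow> (\<exists>k. one_one_degree B = one_one_degree (copies (Suc k) C))"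
proof
  assume "B \<in> bfo_degree (copies 1 C)"
  then have bfo: "bfo_reducible B (copies 1 C)" "bfo_reducible (copies 1 C) B"
    unfolding bfo_degree_def by blast+
  obtain f b where f: "total_recursive f" "\<forall>x. x \<in> B \<longleftrightarrow> f x \<in> copies 1 C" "finite_one f"
      "\<forall>y. card {x. f x = y} \<le> b"
    using bfo(1) by (rule bfo_reducibleE)
  obtain g d where g: "total_recursive g" "\<forall>x. x \<in> copies 1 C \<longleftrightarrow> g x \<in> B" "finite_one g"
      "\<forall>y. card {x. g x = y} \<le> d"
    using bfo(2) by (rule bfo_reducibleE)
  obtain k R where k: "recursive_set R" "finite (C - R)"
      "\<forall>a\<in>R. \<forall>j<Suc k. \<exists>x. f x = 3 * a \<and> rank f x = j"
      "finite {a \<in> C. \<exists>x. f x = 3 * a \<and> Suc k \<le> rank f x}"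
    by (rule almost_constant_multiplicity[OF f(1,3,2,4) g(1,3,2)])
  have "one_one_degree B = one_one_degree (copies (Suc k) C)"
  proof (rule one_one_degree_eqI)
    show "one_one_reducible B (copies (Suc k) C)"
      by (rule reducible_to_copies_of_multiplicity[OF f(1,3,2) k(4)])
    show "one_one_reducible (copies (Suc k) C) B"
      by (rule copies_of_multiplicity_reducible[OF f(1,2) g(1,3,2) k(1-3)])
  qed
  then show "\<exists>k. one_one_degree B = one_one_degree (copies (Suc k) C)" ..
next
  assume "\<exists>k. one_one_degree B = one_one_degree (copies (Suc k) C)"
  then obtain k where "one_one_degree B = one_one_degree (copies (Suc k) C)" ..
  then have "B \<in> one_one_degree (copies (Suc k) C)"
    unfolding one_one_degree_def using one_one_reducible_refl by blast
  then have "one_one_reducible (copies (Suc k) C) B" "one_one_reducible B (copies (Suc k) C)"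
    unfolding one_one_degree_def by blast+
  from this[THEN one_one_reducible_imp_bfo]
  show "B \<in> bfo_degree (copies 1 C)"
    using copies_bfo_reducible_copies_1[of "Suc k" C]
      one_one_reducible_imp_bfo[OF one_one_reducible_copies[of 1 "Suc k" C]]
    unfolding bfo_degree_def by (simp add: bfo_reducible_trans[of _ "copies (Suc k) C"])
qed

lemma one_one_degrees_in_bfo_degree:
  "one_one_degrees_in (bfo_degree (copies 1 C)) = range (\<lambda>k. one_one_degree (copies (Suc k) C))"
proof (intro set_eqI iffI)
  fix d assume "d \<in> one_one_degrees_in (bfo_degree (copies 1 C))"
  then obtain B where B: "d = one_one_degree B" "one_one_degree B \<subseteq> bfo_degree (copies 1 C)"
    unfolding one_one_degrees_in_def by blast
  have "B \<in> one_one_degree B"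
    unfolding one_one_degree_def using one_one_reducible_refl by blast
  then have "B \<in> bfo_degree (copies 1 C)"
    using B(2) by blast
  then show "d \<in> range (\<lambda>k. one_one_degree (copies (Suc k) C))"
    unfolding bfo_degree_classification B(1) by blast
next
  fix d assume "d \<in> range (\<lambda>k. one_one_degree (copies (Suc k) C))"
  then obtain k where d: "d = one_one_degree (copies (Suc k) C)"
    by blast
  have "B \<in> bfo_degree (copies 1 C)" if "B \<in> d" for B
  proof -
    have "one_one_degree B = one_one_degree (copies (Suc k) C)"
      using that unfolding d by (intro one_one_degree_eqI) (simp_all add: one_one_degree_def)
    then show ?thesis
      unfolding bfo_degree_classification by blast
  qed
  then show "d \<in> one_one_degrees_in (bfo_degree (copies 1 C))"
    unfolding one_one_degrees_in_def d by blast
qed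

lemma nonrecursive_bfo_degree: "nonrecursive_degree (bfo_degree (copies 1 C))"
  unfolding nonrecursive_degree_def
proof (intro ballI notI)
  fix B assume "B \<in> bfo_degree (copies 1 C)" and B: "recursive_set B"
  then obtain g where "many_one_reduction g (copies 1 C) B"
    unfolding bfo_degree_def bfo_reducible_def by blast
  with B have "recursive_set (copies 1 C)"
    by (rule recursive_set_reduction)
  moreover have "many_one_reduction (\<lambda>c. 3 * c) C (copies 1 C)"
    unfolding many_one_reduction_def total_recursive_iff copies_1_iff
    by (intro conjI recfun_intros) simp_all
  ultimately have "recursive_set C"
    by (rule recursive_set_reduction)
  then show False
    using not_recursive by blast
qed

lemma one_one_order_bfo_degree_ordIso: "(one_one_order (bfo_degree (copies 1 C)), natLeq) \<in> ordIso"
proof -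
  let ?d = "\<lambda>k. one_one_degree (copies (Suc k) C)"
  have le: "degree_le (?d k) (?d j) \<longleftrightarrow> k \<le> j" for k j
    unfolding degree_le_iff one_one_reducible_copies_iff by simp
  have "one_one_order (bfo_degree (copies 1 C)) = dir_image natLeq ?d"
    unfolding one_one_order_def one_one_degrees_in_bfo_degree dir_image_def natLeq_def
    using le by blast
  moreover have "inj_on ?d (Field natLeq)"
  proof (rule inj_onI)
    fix k j assume "?d k = ?d j"
    then have "degree_le (?d k) (?d j)" "degree_le (?d j) (?d k)"
      using le[of k k] by simp_all
    then show "k = j"
      unfolding le by simp
  qed
  then have "(natLeq, dir_image natLeq ?d) \<in> ordIso"
    by (rule dir_image_ordIso[OF natLeq_Well_order])
  ultimately show ?thesis
    using ordIso_symmetric by simp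
qed

end

theorem theorem19:
  "\<exists>D. D \<in> range bfo_degree \<and> nonrecursive_degree D \<and> (one_one_order D, natLeq) \<in> ordIso"
proof -
  obtain C where "rigid C"
    using rigid_exists ..
  then interpret rigid C .
  show ?thesis
    using nonrecursive_bfo_degree one_one_order_bfo_degree_ordIso by blast
qed

end
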